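(* Let $a>0$ and $n,m\in\mathbb{N}$. Then for all $x$, $$C_{n+m}(x;a)=\sum_{k=0}^{\min(n,m)}\frac{(-n)_k(-m)_k}{k!\,(-a)^k}\,C_{n-k}(x;a)\,C_{m-k}(x-n;a).$$
   Context: $\mathbb N=\{0,1,2,\dots\}$, $(y)_k=y(y+1)\cdots(y+k-1)$. The Charlier polynomials are $$C_n(x;a)=\sum_{j=0}^n\frac{(-n)_j(-x)_j}{j!}\left(-\frac1a\right)^j,$$ polynomials of degree $n$ in $x$. *)

theory Defs
  imports Complex_Main
begin

definition charlier :: "nat \<Rightarrow> 'a::field_char_0 \<Rightarrow> 'a \<Rightarrow> 'a" where
  "charlier n x a =
     (\<Sum>j=0..n. pochhammer (- of_nat n) j * pochhammer (- x) j / fact j * (- (1 / a)) ^ j)"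

end

theory Submission
  imports Defs
begin

text \<open>
  Expanding the Pochhammer symbol of \<open>-n\<close> shows that \<open>C\<^sub>n(x;a)\<close> is the
  binomial sum of the terms \<open>(-x)\<^sub>j / a\<^sup>j\<close>. The operator
  \<open>T f(x) = f(x) - (x/a) f(x-1)\<close> sends the \<open>j\<close>-th of these terms to the sum of the \<open>j\<close>-th and
  the \<open>(j+1)\<close>-st, so Pascal's rule gives \<open>C\<^sub>n = T\<^sup>n 1\<close> (lemma \<open>charlier_Suc\<close>), and
  hence \<open>C\<^bsub>n+m\<^esub> = T\<^sup>n C\<^sub>m\<close>.

  The theorem is the case \<open>f = C\<^sub>m\<close> of the product rule
  \<open>T\<^sup>n f(x) = \<Sum>k\<le>n. (n choose k) C\<^bsub>n-k\<^esub>(x;a) (\<Delta>\<^sup>k f)(x-n)\<close>, where \<open>\<Delta>f(y) = f(y+1) - f(y)\<close>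
  (lemma \<open>product_rule\<close>), which follows by induction on \<open>n\<close>, again with Pascal's rule: in
  \<open>T (C\<^bsub>n-k\<^esub> \<cdot> g)\<close> one writes \<open>g(x) = g(x-1) + \<Delta>g(x-1)\<close>, so that the terms with
  \<open>g(x-1)\<close> combine to \<open>T C\<^bsub>n-k\<^esub> = C\<^bsub>n+1-k\<^esub>\<close>. Finally
  \<open>\<Delta> C\<^sub>m = -(m/a) C\<^bsub>m-1\<^esub>\<close> (lemma \<open>charlier_diff\<close>) makes the iterated
  differences of \<open>C\<^sub>m\<close> explicit: \<open>\<Delta>\<^sup>k C\<^sub>m = (-m)\<^sub>k / a\<^sup>k C\<^bsub>m-k\<^esub>\<close>.
\<close>

text \<open>Pascal's rule in the form in which it drives both inductions on the degree.\<close>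

lemma sum_binomial_Suc:
  fixes h :: "nat \<Rightarrow> 'a::comm_semiring_1"
  shows "(\<Sum>k\<le>Suc n. of_nat (Suc n choose k) * h k) =
         (\<Sum>k\<le>n. of_nat (n choose k) * (h k + h (Suc k)))"
proof -
  have "(\<Sum>k\<le>Suc n. of_nat (Suc n choose k) * h k) =
        h 0 + (\<Sum>k\<le>n. of_nat (n choose Suc k) * h (Suc k)) + (\<Sum>k\<le>n. of_nat (n choose k) * h (Suc k))"
    by (simp add: sum.atMost_Suc_shift sum.distrib algebra_simps del: sum.atMost_Suc)
  also have "h 0 + (\<Sum>k\<le>n. of_nat (n choose Suc k) * h (Suc k)) =
             (\<Sum>k\<le>Suc n. of_nat (n choose k) * h k)"
    by (simp add: sum.atMost_Suc_shift del: sum.atMost_Suc)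
  also have "\<dots> = (\<Sum>k\<le>n. of_nat (n choose k) * h k)"
    by (simp add: binomial_eq_0)
  finally show ?thesis
    by (simp add: sum.distrib algebra_simps)
qed

lemma pochhammer_neg_of_nat_div_fact:
  "pochhammer (- of_nat n) k / fact k = (-1) ^ k * (of_nat (n choose k) :: 'a::field_char_0)"
  by (simp add: binomial_gbinomial gbinomial_pochhammer flip: mult.assoc power_mult_distrib)

lemma charlier_binomial:
  "charlier n x a = (\<Sum>j\<le>n. of_nat (n choose j) * (pochhammer (- x) j / a ^ j))"
  unfolding charlier_def atMost_atLeast0
proof (rule sum.cong[OF refl])
  fix j
  have "pochhammer (- of_nat n) j * pochhammer (- x) j / fact j * (- (1 / a)) ^ j =
        (pochhammer (- of_nat n) j / fact j) * pochhammer (- x) j * ((-1) ^ j / a ^ j)"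
    by (simp add: power_minus[of "1 / a"] power_one_over)
  also have "\<dots> = ((-1) ^ j * (-1) ^ j) * of_nat (n choose j) * (pochhammer (- x) j / a ^ j)"
    unfolding pochhammer_neg_of_nat_div_fact by simp
  finally show "pochhammer (- of_nat n) j * pochhammer (- x) j / fact j * (- (1 / a)) ^ j =
                of_nat (n choose j) * (pochhammer (- x) j / a ^ j)"
    by (simp flip: power_mult_distrib)
qed

lemma charlier_0 [simp]: "charlier 0 x a = 1"
  by (simp add: charlier_def)

lemma charlier_Suc:
  "charlier (Suc n) x a = charlier n x a - x / a * charlier n (x - 1) a"
proof -
  have "pochhammer (- x) (Suc j) / a ^ Suc j =
        - (x / a) * (pochhammer (- (x - 1)) j / a ^ j)" for j
    by (simp add: pochhammer_rec add.commute)
  then show ?thesis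
    unfolding charlier_binomial sum_binomial_Suc
    by (simp only: distrib_left sum.distrib sum_distrib_left sum_negf minus_mult_left[symmetric]
        minus_mult_right[symmetric] add_uminus_conv_diff right_diff_distrib sum_subtractf mult.left_commute)
qed

text \<open>
  Up to scaling, the Charlier polynomials are an Appell sequence for the forward difference:
  \<open>(-y-1)\<^sub>j - (-y)\<^sub>j = -j (-y)\<^bsub>j-1\<^esub>\<close>, and the factor \<open>j\<close> is absorbed into the
  binomial coefficient.
\<close>

lemma charlier_diff:
  "charlier (Suc m) (y + 1) a = charlier (Suc m) y a - of_nat (Suc m) / a * charlier m y a"
proof -
  have diff: "pochhammer (- (y + 1)) (Suc j) =
              pochhammer (- y) (Suc j) - of_nat (Suc j) * pochhammer (- y) j" for j
  proof -
    have "pochhammer (- (y + 1)) (Suc j) = - (y + 1) * pochhammer (- y) j"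
      by (simp add: pochhammer_rec)
    then show ?thesis
      by (simp add: pochhammer_Suc algebra_simps)
  qed
  have term_eq: "of_nat (Suc m choose Suc j) * (pochhammer (- (y + 1)) (Suc j) / a ^ Suc j) =
        of_nat (Suc m choose Suc j) * (pochhammer (- y) (Suc j) / a ^ Suc j)
        - of_nat (Suc m) / a * (of_nat (m choose j) * (pochhammer (- y) j / a ^ j))" for j
  proof -
    have "of_nat (Suc m choose Suc j) * of_nat (Suc j) = of_nat (Suc m) * (of_nat (m choose j) :: 'a)"
      using Suc_times_binomial_eq[of m j] by (metis of_nat_mult)
    then have absorb: "of_nat (Suc m choose Suc j) * (of_nat (Suc j) * c) =
               of_nat (Suc m) * (of_nat (m choose j) * c)" for c :: 'a
      by (metis mult.assoc)
    have "of_nat (Suc m choose Suc j) * (pochhammer (- (y + 1)) (Suc j) / a ^ Suc j) =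
        of_nat (Suc m choose Suc j) * (pochhammer (- y) (Suc j) / a ^ Suc j)
        - of_nat (Suc m choose Suc j) * (of_nat (Suc j) * (pochhammer (- y) j / a ^ Suc j))"
      unfolding diff diff_divide_distrib right_diff_distrib times_divide_eq_right by simp
    then show ?thesis
      unfolding absorb by (simp del: of_nat_Suc binomial_Suc_Suc)
  qed
  have split: "charlier (Suc m) z a = 1 +
      (\<Sum>j\<le>m. of_nat (Suc m choose Suc j) * (pochhammer (- z) (Suc j) / a ^ Suc j))" for z
    unfolding charlier_binomial sum.atMost_Suc_shift by simp
  show ?thesis
    unfolding split term_eq sum_subtractf
    by (simp only: charlier_binomial sum_distrib_left add_diff_eq)
qed

text \<open>
  The product rule for the powers of \<open>T\<close>. Here \<open>G n\<close> stands for \<open>T\<^sup>n f\<close> and \<open>D k\<close> for the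
  iterated difference \<open>\<Delta>\<^sup>k f\<close>; both families are given by their recurrences, so that they can
  be instantiated by closed forms.
\<close>

lemma product_rule:
  fixes G D :: "nat \<Rightarrow> 'a::field_char_0 \<Rightarrow> 'a"
  assumes G_0: "\<And>x. G 0 x = D 0 x"
    and G_Suc: "\<And>n x. G (Suc n) x = G n x - x / a * G n (x - 1)"
    and D_Suc: "\<And>k y. D k (y + 1) = D k y + D (Suc k) y"
  shows "G n x = (\<Sum>k\<le>n. of_nat (n choose k) * (charlier (n - k) x a * D k (x - of_nat n)))"
proof (induction n arbitrary: x)
  case 0
  then show ?case by (simp add: G_0)
next
  case (Suc n)
  define y where "y = x - of_nat (Suc n)"
  have shift: "x - of_nat n = y + 1" "x - 1 - of_nat n = y"
    by (simp_all add: y_def)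
  have "G (Suc n) x = (\<Sum>k\<le>n. of_nat (n choose k) *
          (charlier (n - k) x a * D k (y + 1) - x / a * (charlier (n - k) (x - 1) a * D k y)))"
    unfolding G_Suc Suc.IH shift
    by (simp add: sum_distrib_left right_diff_distrib sum_subtractf mult_ac)
  also have "\<dots> = (\<Sum>k\<le>n. of_nat (n choose k) *
          (charlier (Suc n - k) x a * D k y + charlier (Suc n - Suc k) x a * D (Suc k) y))"
  proof (intro sum.cong refl arg_cong2[where f = "(*)"])
    fix k assume "k \<in> {..n}"
    then have rec: "charlier (Suc n - k) x a =
               charlier (n - k) x a - x / a * charlier (n - k) (x - 1) a"
      by (simp add: Suc_diff_le charlier_Suc)
    show "charlier (n - k) x a * D k (y + 1) - x / a * (charlier (n - k) (x - 1) a * D k y) =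
          charlier (Suc n - k) x a * D k y + charlier (Suc n - Suc k) x a * D (Suc k) y"
      unfolding D_Suc rec diff_Suc_Suc by (simp add: algebra_simps)
  qed
  also have "\<dots> = (\<Sum>k\<le>Suc n. of_nat (Suc n choose k) * (charlier (Suc n - k) x a * D k y))"
    by (rule sum_binomial_Suc[symmetric])
  finally show ?case
    unfolding y_def .
qed

theorem mainTheorem9:
  fixes a :: real and n m :: nat and x :: "'a::real_field"
  assumes "a > 0"
  shows "charlier (n + m) x (of_real a) =
    (\<Sum>k=0..min n m.
       pochhammer (- of_nat n) k * pochhammer (- of_nat m) k / (fact k * (- of_real a) ^ k)
       * charlier (n - k) x (of_real a) * charlier (m - k) (x - of_nat n) (of_real a))"
proof -
  define b :: 'a where "b = of_real a"
  define D where "D k y = pochhammer (- of_nat m) k / b ^ k * charlier (m - k) y b" for k y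
  have D_Suc: "D k (y + 1) = D k y + D (Suc k) y" for k y
  proof (cases "k < m")
    case True
    then obtain d where d: "m = Suc (k + d)"
      using less_iff_Suc_add by blast
    then have m_diff: "m - k = Suc d" "m - Suc k = d"
      by simp_all
    have poch: "pochhammer (- of_nat m) (Suc k) = - (pochhammer (- of_nat m) k * of_nat (Suc d) :: 'a)"
      by (simp add: pochhammer_Suc d algebra_simps)
    show ?thesis
      unfolding D_def m_diff charlier_diff poch
      by (simp add: algebra_simps add_divide_distrib diff_divide_distrib)
  next
    \<comment> \<open>For \<open>k = m\<close> the difference of a constant is taken; for larger \<open>k\<close> everything vanishes.\<close>
    case False
    then show ?thesis
      by (cases "k = m") (simp_all add: D_def pochhammer_of_nat_eq_0_iff)
  qed
  have "charlier (n + m) x b =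
        (\<Sum>k\<le>n. of_nat (n choose k) * (charlier (n - k) x b * D k (x - of_nat n)))"
    by (rule product_rule[where G = "\<lambda>n x. charlier (n + m) x b" and D = D and a = b, OF _ _ D_Suc])
       (simp_all add: D_def charlier_Suc)
  also have "\<dots> = (\<Sum>k=0..min n m. of_nat (n choose k) * (charlier (n - k) x b * D k (x - of_nat n)))"
    by (rule sum.mono_neutral_right) (auto simp: D_def pochhammer_of_nat_eq_0_iff)
  also have "\<dots> = (\<Sum>k=0..min n m.
       pochhammer (- of_nat n) k * pochhammer (- of_nat m) k / (fact k * (- b) ^ k)
       * charlier (n - k) x b * charlier (m - k) (x - of_nat n) b)"
  proof (rule sum.cong[OF refl])
    fix k
    have "pochhammer (- of_nat n) k * pochhammer (- of_nat m) k / (fact k * (- b) ^ k) =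
          (pochhammer (- of_nat n) k / fact k) * pochhammer (- of_nat m) k / ((-1) ^ k * b ^ k)"
      by (simp add: power_minus[of b])
    also have "\<dots> = of_nat (n choose k) * (pochhammer (- of_nat m) k / b ^ k)"
      unfolding pochhammer_neg_of_nat_div_fact by simp
    finally show "of_nat (n choose k) * (charlier (n - k) x b * D k (x - of_nat n)) =
       pochhammer (- of_nat n) k * pochhammer (- of_nat m) k / (fact k * (- b) ^ k)
       * charlier (n - k) x b * charlier (m - k) (x - of_nat n) b"
      by (simp add: D_def mult_ac)
  qed
  finally show ?thesis
    unfolding b_def .
qed

end
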